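(* For every integer $t\geq 1$, the following identity of formal power series in $q$ holds: \[ P_t(q) = \left(\frac{1}{(1-q)(1-q^2)\cdots(1-q^t)} - 1\right) \cdot \frac{1}{1-q^t}. \]
   Context: A partition of a non-negative integer $n$ is a weakly decreasing finite sequence $\lambda_1\geq\cdots\geq\lambda_k>0$ of positive integers with $\lambda_1+\cdots+\lambda_k=n$; write $|\lambda|=n$. For an integer $t\geq 0$, a non-empty partition has bounded difference $t$ if its largest part minus its smallest part is at most $t$. Let $p(n,t)$ be the number of non-empty partitions of $n$ with bounded difference $t$, and $P_t(q)=\sum_{n\geq 1}p(n,t)q^n$. *)

theory Defs
  imports "HOL-Computational_Algebra.Formal_Power_Series"
begin

definition is_partition :: "nat list \<Rightarrow> nat \<Rightarrow> bool" where
  "is_partition xs n \<longleftrightarrow> sorted_wrt (\<ge>) xs \<and> (\<forall>x\<in>set xs. x > 0) \<and> sum_list xs = n"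

text \<open>Natural-number subtraction does not truncate here, since \<open>Min (set xs) \<le> Max (set xs)\<close>
  for every non-empty \<open>xs\<close>.\<close>

definition bounded_difference :: "nat \<Rightarrow> nat list \<Rightarrow> bool" where
  "bounded_difference t xs \<longleftrightarrow> xs \<noteq> [] \<and> Max (set xs) - Min (set xs) \<le> t"

definition bd_partitions :: "nat \<Rightarrow> nat \<Rightarrow> nat list set" where
  "bd_partitions n t = {xs. is_partition xs n \<and> bounded_difference t xs}"

definition bd_count :: "nat \<Rightarrow> nat \<Rightarrow> nat" where
  "bd_count n t = card (bd_partitions n t)"

text \<open>The coefficients are embedded in \<^typ>\<open>rat\<close>, where power series with non-zero constant
  term are invertible.\<close>

definition bd_gf :: "nat \<Rightarrow> rat fps" where
  "bd_gf t = Abs_fps (\<lambda>n. if n \<ge> 1 then of_nat (bd_count n t) else 0)"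

lemma finite_bd_partitions: "finite (bd_partitions n t)"
proof (rule finite_subset)
  have "length xs \<le> sum_list xs" if "\<forall>x\<in>set xs. x > 0" for xs :: "nat list"
    using that by (induction xs) auto
  then show "bd_partitions n t \<subseteq> {xs. set xs \<subseteq> {..n} \<and> length xs \<le> n}"
    by (auto simp: bd_partitions_def is_partition_def intro: member_le_sum_list)
  show "finite {xs. set xs \<subseteq> {..n} \<and> length xs \<le> n}"
    by (rule finite_lists_length_le) simp
qed

end

theory Submission
  imports Defs "HOL-Library.Multiset"
begin

text \<open>
  Let \<open>A m\<close> be the generating function of partitions with parts in \<open>{m..<m + t}\<close> and \<open>G m\<close> that of
  partitions with parts in \<open>{m..m + t}\<close>. Removing from \<open>{m..m + t}\<close> either its largest or its
  smallest element gives \<open>A m = G m * (1 - q ^ (m + t))\<close> and \<open>A (m + 1) = G m * (1 - q ^ m)\<close>, so that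
  \<open>A m - A (m + 1) = q ^ m * G m * (1 - q ^ t)\<close>. Since \<open>q ^ m * G m\<close> counts the partitions with
  smallest part \<open>m\<close> and bounded difference \<open>t\<close>, the sum over \<open>m\<close> telescopes to
  \<open>A 1 - 1 = (1 - q ^ t) * P_t\<close>.
\<close>

unbundle fps_syntax

text \<open>Multisets rather than descending lists, so that adding or removing a part requires no
  reordering.\<close>

definition mset_partitions :: "nat set \<Rightarrow> nat \<Rightarrow> nat multiset set" where
  "mset_partitions S n = {M. set_mset M \<subseteq> S \<and> sum_mset M = n}"

definition mset_partitions_gf :: "nat set \<Rightarrow> rat fps" where
  "mset_partitions_gf S = Abs_fps (\<lambda>n. of_nat (card (mset_partitions S n)))"

lemma size_le_sum_mset:
  assumes "0 \<notin># (M :: nat multiset)"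
  shows "size M \<le> sum_mset M"
  using assms by (induction M) auto

text \<open>Without zero parts, the sum \<open>n\<close> bounds both the size of the multiset and
  each of its elements.\<close>

lemma finite_mset_partitions:
  assumes "0 \<notin> S"
  shows "finite (mset_partitions S n)"
proof (rule finite_subset)
  show "mset_partitions S n \<subseteq> mset ` {xs. set xs \<subseteq> {..n} \<and> length xs \<le> n}"
  proof
    fix M assume M: "M \<in> mset_partitions S n"
    obtain xs where xs: "mset xs = M" using ex_mset by blast
    have "0 \<notin># M" and sum: "sum_mset M = n"
      using M assms by (auto simp: mset_partitions_def)
    then have "length xs \<le> n"
      using size_le_sum_mset[of M] xs by auto
    moreover have "set xs \<subseteq> {..n}"
      using sum xs by (auto simp: sum_mset_sum_list intro: member_le_sum_list)
    ultimately show "M \<in> mset ` {xs. set xs \<subseteq> {..n} \<and> length xs \<le> n}"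
      using xs by auto
  qed
  show "finite (mset ` {xs. set xs \<subseteq> {..n} \<and> length xs \<le> n})"
    by (intro finite_imageI finite_lists_length_le) simp
qed

text \<open>Only one copy of \<open>k\<close> is removed, so further copies may remain and the parts
  are still drawn from all of \<open>S\<close>. The case distinction keeps \<open>n - k\<close> from
  truncating.\<close>

lemma mset_partitions_containing:
  assumes "k \<in> S"
  shows "{M \<in> mset_partitions S n. k \<in># M} =
    (if k \<le> n then add_mset k ` mset_partitions S (n - k) else {})"
proof (intro equalityI subsetI)
  fix M assume "M \<in> {M \<in> mset_partitions S n. k \<in># M}"
  then obtain N where "M = add_mset k N" "M \<in> mset_partitions S n"
    by (auto dest: multi_member_split)
  then show "M \<in> (if k \<le> n then add_mset k ` mset_partitions S (n - k) else {})"
    by (auto simp: mset_partitions_def)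
next
  fix M assume "M \<in> (if k \<le> n then add_mset k ` mset_partitions S (n - k) else {})"
  then show "M \<in> {M \<in> mset_partitions S n. k \<in># M}"
    using assms by (auto simp: mset_partitions_def split: if_splits)
qed

lemma card_mset_partitions_containing:
  assumes "k \<in> S"
  shows "card {M \<in> mset_partitions S n. k \<in># M} =
    (if k \<le> n then card (mset_partitions S (n - k)) else 0)"
  by (auto simp: mset_partitions_containing[OF assms] card_image inj_on_def)

text \<open>Splitting by whether \<open>k\<close> occurs gives \<open>G = F + q ^ k * G\<close>,
  where \<open>G\<close> and \<open>F\<close> belong to \<open>insert k S\<close> and
  \<open>S\<close>.\<close>

lemma mset_partitions_gf_insert:
  assumes "0 \<notin> insert k S" "k \<notin> S"
  shows "mset_partitions_gf (insert k S) * (1 - fps_X ^ k) = mset_partitions_gf S"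
proof (rule fps_ext)
  fix n
  let ?P = "mset_partitions (insert k S)"
  have "?P n = mset_partitions S n \<union> {M \<in> ?P n. k \<in># M}"
    by (auto simp: mset_partitions_def)
  moreover have "mset_partitions S n \<inter> {M \<in> ?P n. k \<in># M} = {}"
    using assms by (auto simp: mset_partitions_def)
  ultimately have "card (?P n) = card (mset_partitions S n) + card {M \<in> ?P n. k \<in># M}"
    using finite_mset_partitions[OF assms(1)] finite_mset_partitions[of S] assms(1)
    by (metis (no_types, lifting) card_Un_disjoint finite_Un)
  then show "(mset_partitions_gf (insert k S) * (1 - fps_X ^ k)) $ n = mset_partitions_gf S $ n"
    by (auto simp: card_mset_partitions_containing mset_partitions_gf_def
        right_diff_distrib fps_X_power_mult_right_nth not_less)
qed

text \<open>A single part already exceeds \<open>n\<close>, so only the empty multiset can have sum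
  \<open>n\<close>.\<close>

lemma mset_partitions_gf_nth_below:
  assumes "\<And>x. x \<in> S \<Longrightarrow> n < x"
  shows "mset_partitions_gf S $ n = (if n = 0 then 1 else 0)"
proof -
  have "mset_partitions S n \<subseteq> {{#}}"
  proof
    fix M assume "M \<in> mset_partitions S n"
    then show "M \<in> {{#}}"
      using assms by (cases M) (fastforce simp: mset_partitions_def)+
  qed
  moreover have "{#} \<in> mset_partitions S n \<longleftrightarrow> n = 0"
    by (auto simp: mset_partitions_def)
  ultimately have "mset_partitions S n = (if n = 0 then {{#}} else {})"
    unfolding subset_singleton_iff by auto
  then show ?thesis
    by (simp add: mset_partitions_gf_def)
qed

text \<open>Euler's product for a finite set of parts: each inserted part is cancelled by its own
  factor.\<close>

lemma mset_partitions_gf_prod: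
  assumes "finite S" "0 \<notin> S"
  shows "mset_partitions_gf S * (\<Prod>k\<in>S. 1 - fps_X ^ k) = 1"
  using assms
proof (induction S rule: finite_induct)
  case empty
  show ?case by (rule fps_ext) (use mset_partitions_gf_nth_below[of "{}"] in simp)
next
  case (insert k S)
  then show ?case
    using mset_partitions_gf_insert[of k S] by (simp flip: mult.assoc)
qed

text \<open>A descending list is determined by its multiset of entries: it is the reverse of the
  ascending sort.\<close>

lemma bij_betw_mset_bd_partitions:
  "bij_betw mset (bd_partitions n t)
     {M. M \<noteq> {#} \<and> 0 \<notin># M \<and> sum_mset M = n \<and> Max (set_mset M) - Min (set_mset M) \<le> t}"
proof (rule bij_betw_byWitness[where f' = "\<lambda>M. rev (sorted_list_of_multiset M)"])
  show "\<forall>xs\<in>bd_partitions n t. rev (sorted_list_of_multiset (mset xs)) = xs"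
  proof
    fix xs assume "xs \<in> bd_partitions n t"
    then have "sorted (rev xs)"
      by (simp add: bd_partitions_def is_partition_def sorted_wrt_rev)
    then have "sort xs = rev xs"
      by (intro properties_for_sort) auto
    then show "rev (sorted_list_of_multiset (mset xs)) = xs"
      by simp
  qed
  show "(\<lambda>M. rev (sorted_list_of_multiset M)) `
    {M. M \<noteq> {#} \<and> 0 \<notin># M \<and> sum_mset M = n \<and> Max (set_mset M) - Min (set_mset M) \<le> t}
    \<subseteq> bd_partitions n t"
  proof (clarsimp simp: bd_partitions_def is_partition_def bounded_difference_def sorted_wrt_rev
      sum_list_rev)
    fix M :: "nat multiset"
    assume "M \<noteq> {#}" "0 \<notin># M"
    moreover have "sum_list (sorted_list_of_multiset M) = sum_mset M"
      by (metis mset_sorted_list_of_multiset sum_mset_sum_list)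
    moreover have "sorted_list_of_multiset M \<noteq> []"
      using \<open>M \<noteq> {#}\<close> by (metis mset.simps(1) mset_sorted_list_of_multiset)
    ultimately show "(\<forall>x\<in>#M. 0 < x) \<and> sum_list (sorted_list_of_multiset M) = sum_mset M \<and>
      sorted_list_of_multiset M \<noteq> []"
      by (metis gr0I)
  qed
qed (auto simp: bd_partitions_def is_partition_def bounded_difference_def sum_mset_sum_list)

text \<open>Partitions are classified by their smallest part \<open>m\<close>, which is at most the
  sum \<open>n\<close>.\<close>

lemma bd_count_eq_sum:
  "bd_count n t = (\<Sum>m=1..n. card {M \<in> mset_partitions {m..m + t} n. m \<in># M})"
proof -
  let ?B = "\<lambda>m. {M \<in> mset_partitions {m..m + t} n. m \<in># M}"
  have Min: "Min (set_mset M) = m" if "M \<in> ?B m" for M m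
    using that by (intro Min_eqI) (auto simp: mset_partitions_def)
  have "{M. M \<noteq> {#} \<and> 0 \<notin># M \<and> sum_mset M = n \<and> Max (set_mset M) - Min (set_mset M) \<le> t}
    = (\<Union>m\<in>{1..n}. ?B m)" (is "?L = ?R")
  proof (intro equalityI subsetI)
    fix M assume M: "M \<in> ?L"
    define m where "m = Min (set_mset M)"
    have m: "m \<in># M"
      using M by (auto simp: m_def intro!: Min_in)
    then have "m \<noteq> 0" "m \<le> n"
      using M by (auto dest: multi_member_split)
    moreover have "x \<in> {m..m + t}" if "x \<in># M" for x
    proof -
      have "x \<le> Max (set_mset M)" "m \<le> x"
        using that by (auto simp: m_def)
      then show ?thesis using M by (auto simp: m_def)
    qed
    ultimately show "M \<in> ?R"
      using M m by (auto simp: mset_partitions_def intro!: bexI[of _ m])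
  next
    fix M assume "M \<in> ?R"
    then obtain m where m: "m \<in> {1..n}" "M \<in> ?B m" by blast
    then have "M \<noteq> {#}" by auto
    then have "Max (set_mset M) \<in># M" by (intro Max_in) auto
    then have "Max (set_mset M) \<le> m + t" using m by (auto simp: mset_partitions_def)
    then show "M \<in> ?L"
      using m Min[OF m(2)] by (auto simp: mset_partitions_def)
  qed
  then have "bd_count n t = card (\<Union>m\<in>{1..n}. ?B m)"
    unfolding bd_count_def using bij_betw_same_card[OF bij_betw_mset_bd_partitions] by simp
  also have "\<dots> = (\<Sum>m=1..n. card (?B m))"
  proof (rule card_UN_disjoint)
    show "\<forall>m\<in>{1..n}. finite (?B m)"
      by (simp add: finite_mset_partitions)
    show "\<forall>i\<in>{1..n}. \<forall>j\<in>{1..n}. i \<noteq> j \<longrightarrow> ?B i \<inter> ?B j = {}"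
      using Min by blast
  qed simp
  finally show ?thesis .
qed

text \<open>The sum over all smallest parts may be cut off at any \<open>N \<ge> n\<close>, since
  the terms with \<open>m > n\<close> are multiples of \<open>q ^ m\<close>.\<close>

lemma bd_gf_nth:
  assumes "n \<le> N"
  shows "bd_gf t $ n = (\<Sum>m=1..N. fps_X ^ m * mset_partitions_gf {m..m + t}) $ n"
proof -
  \<comment> \<open>At \<open>n = 0\<close> the sum for \<open>bd_count\<close> is empty, in
    agreement with the constant coefficient 0 of \<open>bd_gf\<close>.\<close>
  have "bd_gf t $ n = of_nat (bd_count n t)"
    by (simp add: bd_gf_def bd_count_eq_sum)
  also have "\<dots> = (\<Sum>m=1..n. (fps_X ^ m * mset_partitions_gf {m..m + t}) $ n)"
    by (auto simp: bd_count_eq_sum card_mset_partitions_containing mset_partitions_gf_def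
        fps_X_power_mult_nth intro!: sum.cong)
  also have "\<dots> = (\<Sum>m=1..N. (fps_X ^ m * mset_partitions_gf {m..m + t}) $ n)"
    using assms by (intro sum.mono_neutral_left) (auto simp: fps_X_power_mult_nth)
  finally show ?thesis
    by (simp add: fps_sum_nth)
qed

lemma mset_partitions_gf_window_step:
  assumes "m \<ge> 1"
  shows "fps_X ^ m * mset_partitions_gf {m..m + t} * (1 - fps_X ^ t) =
    mset_partitions_gf {m..<m + t} - mset_partitions_gf {Suc m..<Suc m + t}"
proof -
  let ?G = "mset_partitions_gf {m..m + t}"
  have "{m..m + t} = insert (m + t) {m..<m + t}" "{m..m + t} = insert m {Suc m..<Suc m + t}"
    by auto
  then have G: "?G * (1 - fps_X ^ (m + t)) = mset_partitions_gf {m..<m + t}"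
    "?G * (1 - fps_X ^ m) = mset_partitions_gf {Suc m..<Suc m + t}"
    using mset_partitions_gf_insert[of "m + t" "{m..<m + t}"]
      mset_partitions_gf_insert[of m "{Suc m..<Suc m + t}"] assms by auto
  then show ?thesis
    unfolding G[symmetric] by (simp add: power_add algebra_simps)
qed

lemma bd_gf_times:
  "bd_gf t * (1 - fps_X ^ t) = mset_partitions_gf {1..t} - 1"
proof (rule fps_ext)
  fix n
  let ?A = "\<lambda>m. mset_partitions_gf {m..<m + t}"
  let ?S = "\<Sum>m=1..n. fps_X ^ m * mset_partitions_gf {m..m + t}"
  have "?S * (1 - fps_X ^ t) = (\<Sum>m=1..n. ?A m - ?A (Suc m))"
    unfolding sum_distrib_right by (intro sum.cong refl mset_partitions_gf_window_step) auto
  also have "\<dots> = ?A 1 - ?A (Suc n)"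
    by (induction n) auto
  finally have S: "?S * (1 - fps_X ^ t) = ?A 1 - ?A (Suc n)" .
  \<comment> \<open>Coefficient \<open>n\<close> of the product involves only coefficients of
    \<open>bd_gf t\<close> up to \<open>n\<close>, and on these the cut-off sum \<open>?S\<close>
    agrees with it.\<close>
  have "(bd_gf t * (1 - fps_X ^ t)) $ n = (?S * (1 - fps_X ^ t)) $ n"
    unfolding fps_mult_nth by (intro sum.cong refl arg_cong2[of _ _ _ _ "(*)"] bd_gf_nth) auto
  \<comment> \<open>All parts in the last window exceed \<open>n\<close>, so
    \<open>?A (Suc n)\<close> looks like the series 1 at coefficient \<open>n\<close>.\<close>
  also have "\<dots> = ?A 1 $ n - (if n = 0 then 1 else 0)"
    unfolding S using mset_partitions_gf_nth_below[of "{Suc n..<Suc n + t}" n] by simp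
  also have "{1..<1 + t} = {1..t}" by auto
  finally show "(bd_gf t * (1 - fps_X ^ t)) $ n = (mset_partitions_gf {1..t} - 1) $ n"
    by simp
qed

theorem theorem1:
  fixes t :: nat
  assumes "t \<ge> 1"
  shows "bd_gf t = (1 / (\<Prod>k=1..t. (1 - fps_X ^ k)) - 1) * (1 / (1 - fps_X ^ t))"
proof -
  let ?Q = "\<Prod>k=1..t. (1 - fps_X ^ k) :: rat fps"
  have gf: "mset_partitions_gf {1..t} * ?Q = 1"
    by (rule mset_partitions_gf_prod) auto
  then have "?Q \<noteq> 0"
    by (intro notI) (simp only: mult_zero_right zero_neq_one)
  then have Q: "1 / ?Q = mset_partitions_gf {1..t}"
    using nonzero_mult_div_cancel_right[of ?Q "mset_partitions_gf {1..t}"] unfolding gf by blast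
  \<comment> \<open>As \<open>t \<ge> 1\<close>, the constant coefficient is 1, so
    \<open>1 - q ^ t\<close> is invertible.\<close>
  have unit: "(1 - fps_X ^ t :: rat fps) $ 0 \<noteq> 0"
    using assms by simp
  then have "bd_gf t = bd_gf t * (1 - fps_X ^ t) * (1 / (1 - fps_X ^ t))"
    by (simp add: fps_divide_unit mult.assoc inverse_mult_eq_1')
  then show ?thesis
    unfolding Q bd_gf_times .
qed

end
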